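(* Let $\hat q,m$ be positive integers, let $\bar n^1,\ldots,\bar n^{\hat q}$ be positive integers, let $C^q_k\in\mathbb{S}^{\bar n^q}$ $(1\le q\le\hat q,\ 0\le k\le m)$, let $\delta=(\delta_1,\ldots,\delta_m)\in\mathbb{R}^m$, and for each $k=1,\ldots,m$ let $\trianglelefteq_k$ be one of the relations $\le$, $=$, $\ge$. Consider the separable homogeneous QCQP $$\text{(QCQP)}\quad \zeta(\delta)=\inf\Big\{\sum_{q=1}^{\hat q}\langle C^q_0,v^q(v^q)^T\rangle: v^q\in\mathbb{R}^{\bar n^q}\ (1\le q\le\hat q),\ \sum_{q=1}^{\hat q}\langle C^q_k,v^q(v^q)^T\rangle\trianglelefteq_k\delta_k\ (1\le k\le m)\Big\}$$ and its SDP relaxation $$\text{(SDPR)}\quad \eta(\delta)=\inf\Big\{\sum_{q=1}^{\hat q}\langle C^q_0,V^q\rangle: V^q\in\mathbb{S}^{\bar n^q}_+\ (1\le q\le\hat q),\ \sum_{q=1}^{\hat q}\langle C^q_k,V^q\rangle\trianglelefteq_k\delta_k\ (1\le k\le m)\Big\}.$$ Assume that (A) for every optimal solution $(V^1,\ldots,V^{\hat q})$ of (SDPR), at least $m-1$ of the $\hat q+m$ quantities $$V^q\in\mathbb{S}^{\bar n^q}\ (1\le q\le\hat q)\quad\text{and}\quad \delta_k-\sum_{q=1}^{\hat q}\langle C^q_k,V^q\rangle\in\mathbb{R}\ (1\le k\le m)$$ are nonzero; and (B) (SDPR) has an optimal solution. Then (SDPR) admits an optimal solution $(\widetilde V^1,\ldots,\widetilde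 V^{\hat q})$ such that $\operatorname{rank}(\widetilde V^q)\le 1$ for all $1\le q\le\hat q$. Consequently, $\widetilde V^q=\bar v^q(\bar v^q)^T$ for some $\bar v^q\in\mathbb{R}^{\bar n^q}$ $(1\le q\le\hat q)$, and $(\bar v^1,\ldots,\bar v^{\hat q})$ is an optimal solution of (QCQP).
   Context: $\mathbb{S}^n$ is the space of real symmetric $n\times n$ matrices with inner product $\langle A,B\rangle=\sum_{i,j}A_{ij}B_{ij}$, and $\mathbb{S}^n_+$ is the cone of positive semidefinite matrices in $\mathbb{S}^n$. An optimal solution of a problem is a feasible point attaining the infimum. In (A), the quantities are counted as an indexed family (one entry for each $q$ and one for each $k$). *)

theory Defs
  imports
    "Jordan_Normal_Form.DL_Rank"
    "HOL-Library.Extended_Real"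
begin

definition sym_mats :: "nat \<Rightarrow> real mat set" where
  "sym_mats n = {A \<in> carrier_mat n n. transpose_mat A = A}"

definition psd_mats :: "nat \<Rightarrow> real mat set" where
  "psd_mats n = {A \<in> sym_mats n. \<forall>x \<in> carrier_vec n. 0 \<le> x \<bullet> (A *\<^sub>v x)}"

definition mat_inner :: "real mat \<Rightarrow> real mat \<Rightarrow> real" where
  "mat_inner A B = (\<Sum>i<dim_row A. \<Sum>j<dim_col A. A $$ (i, j) * B $$ (i, j))"

text \<open>The rank-one matrix \<open>v v\<^sup>T\<close>.\<close>

definition outer_sq :: "real vec \<Rightarrow> real mat" where
  "outer_sq v = mat (dim_vec v) (dim_vec v) (\<lambda>(i, j). v $ i * v $ j)"

text \<open>
  Since the dimension varies with the block, the data are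
  families indexed by natural numbers: block indices \<open>q\<close> range over \<open>{1..Q}\<close>, block \<open>q\<close> has
  dimension \<open>n q\<close>, the constraints are indexed by \<open>{1..m}\<close>, and \<open>C q k\<close> is the coefficient matrix
  of block \<open>q\<close> in constraint \<open>k\<close>, or in the objective if \<open>k = 0\<close>. Values of the families outside
  these ranges are irrelevant.
\<close>

definition block_sum :: "nat \<Rightarrow> (nat \<Rightarrow> nat \<Rightarrow> real mat) \<Rightarrow> nat \<Rightarrow> (nat \<Rightarrow> real mat) \<Rightarrow> real" where
  "block_sum Q C k V = (\<Sum>q = 1..Q. mat_inner (C q k) (V q))"

definition qcqp_feasible ::
  "nat \<Rightarrow> (nat \<Rightarrow> nat) \<Rightarrow> nat \<Rightarrow> (nat \<Rightarrow> nat \<Rightarrow> real mat) \<Rightarrow> (nat \<Rightarrow> real \<Rightarrow> real \<Rightarrow> bool)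
    \<Rightarrow> (nat \<Rightarrow> real) \<Rightarrow> (nat \<Rightarrow> real vec) set" where
  "qcqp_feasible Q n m C R \<delta> =
    {v. (\<forall>q \<in> {1..Q}. v q \<in> carrier_vec (n q)) \<and>
        (\<forall>k \<in> {1..m}. R k (block_sum Q C k (\<lambda>q. outer_sq (v q))) (\<delta> k))}"

text \<open>
  The optimal values are infima in the extended reals: \<open>\<infinity>\<close> for an infeasible problem and
  \<open>-\<infinity>\<close> for an unbounded one.
\<close>

definition qcqp_value ::
  "nat \<Rightarrow> (nat \<Rightarrow> nat) \<Rightarrow> nat \<Rightarrow> (nat \<Rightarrow> nat \<Rightarrow> real mat) \<Rightarrow> (nat \<Rightarrow> real \<Rightarrow> real \<Rightarrow> bool)
    \<Rightarrow> (nat \<Rightarrow> real) \<Rightarrow> ereal" where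
  "qcqp_value Q n m C R \<delta> =
    (INF v \<in> qcqp_feasible Q n m C R \<delta>. ereal (block_sum Q C 0 (\<lambda>q. outer_sq (v q))))"

definition qcqp_optimal ::
  "nat \<Rightarrow> (nat \<Rightarrow> nat) \<Rightarrow> nat \<Rightarrow> (nat \<Rightarrow> nat \<Rightarrow> real mat) \<Rightarrow> (nat \<Rightarrow> real \<Rightarrow> real \<Rightarrow> bool)
    \<Rightarrow> (nat \<Rightarrow> real) \<Rightarrow> (nat \<Rightarrow> real vec) \<Rightarrow> bool" where
  "qcqp_optimal Q n m C R \<delta> v \<longleftrightarrow>
    v \<in> qcqp_feasible Q n m C R \<delta> \<and>
    ereal (block_sum Q C 0 (\<lambda>q. outer_sq (v q))) = qcqp_value Q n m C R \<delta>"

definition sdpr_feasible ::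
  "nat \<Rightarrow> (nat \<Rightarrow> nat) \<Rightarrow> nat \<Rightarrow> (nat \<Rightarrow> nat \<Rightarrow> real mat) \<Rightarrow> (nat \<Rightarrow> real \<Rightarrow> real \<Rightarrow> bool)
    \<Rightarrow> (nat \<Rightarrow> real) \<Rightarrow> (nat \<Rightarrow> real mat) set" where
  "sdpr_feasible Q n m C R \<delta> =
    {V. (\<forall>q \<in> {1..Q}. V q \<in> psd_mats (n q)) \<and>
        (\<forall>k \<in> {1..m}. R k (block_sum Q C k V) (\<delta> k))}"

definition sdpr_value ::
  "nat \<Rightarrow> (nat \<Rightarrow> nat) \<Rightarrow> nat \<Rightarrow> (nat \<Rightarrow> nat \<Rightarrow> real mat) \<Rightarrow> (nat \<Rightarrow> real \<Rightarrow> real \<Rightarrow> bool)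
    \<Rightarrow> (nat \<Rightarrow> real) \<Rightarrow> ereal" where
  "sdpr_value Q n m C R \<delta> =
    (INF V \<in> sdpr_feasible Q n m C R \<delta>. ereal (block_sum Q C 0 V))"

definition sdpr_optimal ::
  "nat \<Rightarrow> (nat \<Rightarrow> nat) \<Rightarrow> nat \<Rightarrow> (nat \<Rightarrow> nat \<Rightarrow> real mat) \<Rightarrow> (nat \<Rightarrow> real \<Rightarrow> real \<Rightarrow> bool)
    \<Rightarrow> (nat \<Rightarrow> real) \<Rightarrow> (nat \<Rightarrow> real mat) \<Rightarrow> bool" where
  "sdpr_optimal Q n m C R \<delta> V \<longleftrightarrow>
    V \<in> sdpr_feasible Q n m C R \<delta> \<and>
    ereal (block_sum Q C 0 V) = sdpr_value Q n m C R \<delta>"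

end

(* A positive semidefinite matrix is a sum of squares x x^T. Among all optimal solutions of (SDPR)
   written blockwise in this way, take one minimising the total number of summands plus the number of
   nonzero slacks. If some block still had two summands x x^T + y y^T, perturb it by
   a x x^T + b (x y^T + y x^T) + d y y^T, rescale every other block carrying a summand, and rescale
   the nonzero slacks. By (A) these are at least m + 1 parameters subject to m linear equations, so
   there is a nonzero admissible direction; following it to the boundary of the feasible set keeps
   optimality and removes a summand or a slack. *)

theory Submission
  imports Defs
begin

section \<open>Underdetermined homogeneous linear systems\<close>

text \<open>Gaussian elimination by induction on the equations: an equation with a nonzero
  coefficient is solved for one unknown, so both cardinalities drop by one; an equation whose
  coefficients all vanish is discarded.\<close>

lemma homogeneous_system_nontrivial_solution:
  fixes f :: "'k \<Rightarrow> 'i \<Rightarrow> 'a::field"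
  assumes "finite K" "finite I" "card K < card I"
  shows "\<exists>c. (\<exists>i\<in>I. c i \<noteq> 0) \<and> (\<forall>k\<in>K. (\<Sum>i\<in>I. c i * f k i) = 0)"
  using assms
proof (induction K arbitrary: I f rule: finite_induct)
  case empty
  then have "I \<noteq> {}" by auto
  then show ?case by (intro exI[of _ "\<lambda>_. 1"]) auto
next
  case (insert k K)
  show ?case
  proof (cases "\<forall>i\<in>I. f k i = 0")
    case True
    have "card K < card I" using insert.prems(2) insert.hyps by simp
    from insert.IH[OF insert.prems(1) this, of f] obtain c
      where "\<exists>i\<in>I. c i \<noteq> 0" "\<forall>l\<in>K. (\<Sum>i\<in>I. c i * f l i) = 0" by blast
    moreover have "(\<Sum>i\<in>I. c i * f k i) = 0" using True by simp
    ultimately show ?thesis by (intro exI[of _ c]) blast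
  next
    case False
    then obtain i0 where i0: "i0 \<in> I" "f k i0 \<noteq> 0" by blast
    \<comment> \<open>Solving equation \<open>k\<close> for the unknown \<open>i0\<close> and
      substituting leaves equations on \<open>?J\<close> with coefficients
      \<open>f l i - f k i * (f l i0 / f k i0)\<close>.\<close>
    let ?J = "I - {i0}"
    have "card K < card ?J" using insert.prems insert.hyps i0 by simp
    with insert.prems(1) obtain c where c: "\<exists>i\<in>?J. c i \<noteq> 0"
      "\<forall>l\<in>K. (\<Sum>i\<in>?J. c i * (f l i - f k i * (f l i0 / f k i0))) = 0"
      using insert.IH[of ?J "\<lambda>l i. f l i - f k i * (f l i0 / f k i0)"] by blast
    define S where "S = (\<Sum>i\<in>?J. c i * f k i)"
    \<comment> \<open>Back substitution: the value at \<open>i0\<close> is the one forced by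
      equation \<open>k\<close>.\<close>
    define d where "d i = (if i = i0 then - S / f k i0 else c i)" for i
    have split: "(\<Sum>i\<in>I. d i * f l i) = - S / f k i0 * f l i0 + (\<Sum>i\<in>?J. c i * f l i)" for l
    proof -
      have "(\<Sum>i\<in>I. d i * f l i) = d i0 * f l i0 + (\<Sum>i\<in>?J. d i * f l i)"
        by (rule sum.remove[OF insert.prems(1) i0(1)])
      also have "(\<Sum>i\<in>?J. d i * f l i) = (\<Sum>i\<in>?J. c i * f l i)"
        by (rule sum.cong) (auto simp: d_def)
      finally show ?thesis by (simp add: d_def)
    qed
    have "(\<Sum>i\<in>I. d i * f l i) = 0" if "l \<in> insert k K" for l
    proof (cases "l = k")
      case True
      then show ?thesis using split[of k] i0(2) by (simp add: S_def[symmetric])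
    next
      case False
      then have "0 = (\<Sum>i\<in>?J. c i * (f l i - f k i * (f l i0 / f k i0)))"
        using c(2) that by simp
      also have "\<dots> = (\<Sum>i\<in>?J. c i * f l i - (c i * f k i) * (f l i0 / f k i0))"
        by (rule sum.cong) (simp_all add: right_diff_distrib mult.assoc)
      also have "\<dots> = (\<Sum>i\<in>?J. c i * f l i) - S * (f l i0 / f k i0)"
        by (simp only: sum_subtractf S_def sum_distrib_right)
      finally show ?thesis unfolding split[of l] by simp
    qed
    moreover from c(1) obtain j where "j \<in> ?J" "c j \<noteq> 0" by blast
    then have "\<exists>i\<in>I. d i \<noteq> 0" by (intro bexI[of _ j]) (simp_all add: d_def)
    ultimately show ?thesis by blast
  qed
qed

section \<open>Positive semidefinite forms as sums of squares\<close>

text \<open>Second-order expansion along the \<open>k\<close>-th coordinate axis, exact because the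
  form is quadratic. It serves to isolate single entries of \<open>A\<close> and to complete the
  square at a pivot.\<close>

lemma quadratic_form_add_unit:
  fixes A :: "nat \<Rightarrow> nat \<Rightarrow> real"
  assumes "\<forall>i<n. \<forall>j<n. A i j = A j i" and "k < n"
  shows "(\<Sum>i<n. \<Sum>j<n. A i j * (x i + (if i = k then s else 0)) * (x j + (if j = k then s else 0)))
    = (\<Sum>i<n. \<Sum>j<n. A i j * x i * x j) + 2 * s * (\<Sum>j<n. A k j * x j) + s\<^sup>2 * A k k"
proof -
  have "(\<Sum>j<n. A i j * (x i + (if i = k then s else 0)) * (x j + (if j = k then s else 0)))
    = (\<Sum>j<n. A i j * x i * x j) + s * (A i k * x i)
      + (if i = k then s * (\<Sum>j<n. A i j * x j) + s\<^sup>2 * A k k else 0)"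
    if "i < n" for i
  proof -
    have "(\<Sum>j<n. A i j * (x i + (if i = k then s else 0)) * (x j + (if j = k then s else 0)))
      = (\<Sum>j<n. A i j * x i * x j) + (\<Sum>j<n. if j = k then s * (A i k * x i) else 0)
      + ((if i = k then s else 0) * (\<Sum>j<n. A i j * x j)
         + (\<Sum>j<n. if j = k then (if i = k then s else 0) * s * A i k else 0))"
      unfolding sum.distrib[symmetric] sum_distrib_left
      by (rule sum.cong) (auto simp: algebra_simps)
    then show ?thesis using \<open>k < n\<close> by (auto simp: power2_eq_square)
  qed
  then have "(\<Sum>i<n. \<Sum>j<n. A i j * (x i + (if i = k then s else 0)) * (x j + (if j = k then s else 0)))
    = (\<Sum>i<n. (\<Sum>j<n. A i j * x i * x j) + s * (A i k * x i)
      + (if i = k then s * (\<Sum>j<n. A i j * x j) + s\<^sup>2 * A k k else 0))"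
    by simp
  also have "\<dots> = (\<Sum>i<n. \<Sum>j<n. A i j * x i * x j) + s * (\<Sum>i<n. A i k * x i)
      + (s * (\<Sum>j<n. A k j * x j) + s\<^sup>2 * A k k)"
    using \<open>k < n\<close> by (simp add: sum.distrib sum_distrib_left)
  also have "(\<Sum>i<n. A i k * x i) = (\<Sum>i<n. A k i * x i)"
    using assms by (intro sum.cong) auto
  finally show ?thesis by simp
qed

text \<open>Cholesky factorisation: eliminating a nonzero pivot \<open>A k k\<close> leaves a positive semidefinite
  form with one more vanishing diagonal entry.\<close>

lemma psd_form_sum_of_squares:
  fixes A :: "nat \<Rightarrow> nat \<Rightarrow> real"
  assumes "\<forall>i<n. \<forall>j<n. A i j = A j i"
    and "\<forall>x. 0 \<le> (\<Sum>i<n. \<Sum>j<n. A i j * x i * x j)"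
  shows "\<exists>xs :: (nat \<Rightarrow> real) list. \<forall>i<n. \<forall>j<n. A i j = (\<Sum>x\<leftarrow>xs. x i * x j)"
  using assms
proof (induction "card {i. i < n \<and> A i i \<noteq> 0}" arbitrary: A rule: less_induct)
  case less
  note sym = less.prems(1) and psd = less.prems(2)
  \<comment> \<open>A diagonal entry is the value of the form at a unit vector, here reached from
    the zero vector.\<close>
  have diag: "0 \<le> B i i" if "\<forall>i<n. \<forall>j<n. B i j = B j i"
    "\<forall>x. 0 \<le> (\<Sum>i<n. \<Sum>j<n. B i j * x i * x j)" "i < n" for B :: "nat \<Rightarrow> nat \<Rightarrow> real" and i
    using that(2)[rule_format, of "\<lambda>j. 0 + (if j = i then 1 else 0)"]
    unfolding quadratic_form_add_unit[OF that(1) that(3), where x = "\<lambda>_. 0" and s = 1] by simp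
  show ?case
  proof (cases "\<forall>i<n. A i i = 0")
    case True
    \<comment> \<open>With zero diagonal, the form at \<open>e_i + s * e_j\<close> equals
      \<open>2 * s * A j i\<close>, which is linear in \<open>s\<close>; nonnegativity for
      \<open>s = 1\<close> and \<open>s = -1\<close> forces the entry to vanish.\<close>
    have "A i j = 0" if ij: "i < n" "j < n" for i j
    proof -
      let ?e = "\<lambda>l. 0 + (if l = i then 1 else (0::real))"
      have e: "(\<Sum>k<n. \<Sum>l<n. A k l * ?e k * ?e l) = 0"
        using quadratic_form_add_unit[OF sym ij(1), where x = "\<lambda>_. 0" and s = 1] True ij by simp
      have ee: "(\<Sum>l<n. A j l * ?e l) = A j i"
        using ij by (simp add: if_distrib cong: if_cong)
      have "0 \<le> 2 * s * A j i" for s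
        using psd[rule_format, of "\<lambda>l. ?e l + (if l = j then s else 0)"] True ij(2)
        unfolding quadratic_form_add_unit[OF sym ij(2), where x = ?e and s = s] e ee by simp
      from this[of 1] this[of "-1"] show ?thesis using sym ij by simp
    qed
    then show ?thesis by (intro exI[of _ "[]"]) simp
  next
    case False
    then obtain k where k: "k < n" "A k k \<noteq> 0" by blast
    then have kpos: "A k k > 0" using diag[OF sym psd k(1)] by simp
    \<comment> \<open>The Schur complement of the pivot, with row \<open>k\<close> cleared.\<close>
    define B where "B i j = A i j - A k i * A k j / A k k" for i j
    have Bsym: "\<forall>i<n. \<forall>j<n. B i j = B j i"
      using sym by (simp add: B_def)
    have Bpsd: "\<forall>x. 0 \<le> (\<Sum>i<n. \<Sum>j<n. B i j * x i * x j)"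
    proof
      fix x :: "nat \<Rightarrow> real"
      let ?r = "\<Sum>j<n. A k j * x j"
      have "(\<Sum>i<n. \<Sum>j<n. B i j * x i * x j)
        = (\<Sum>i<n. \<Sum>j<n. A i j * x i * x j) - (\<Sum>i<n. \<Sum>j<n. (A k i * x i) * (A k j * x j)) / A k k"
        unfolding B_def sum_divide_distrib sum_subtractf[symmetric]
        by (intro sum.cong) (simp_all add: left_diff_distrib mult.assoc mult.left_commute)
      also have "(\<Sum>i<n. \<Sum>j<n. (A k i * x i) * (A k j * x j)) = ?r * ?r"
        by (simp only: sum_product)
      \<comment> \<open>Completing the square: the form of \<open>B\<close> at \<open>x\<close> is
        the minimum of the form of \<open>A\<close> on the line through \<open>x\<close> along axis
        \<open>k\<close>, attained at the shift \<open>- ?r / A k k\<close>.\<close>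
      also have "(\<Sum>i<n. \<Sum>j<n. A i j * x i * x j) - ?r * ?r / A k k
        = (\<Sum>i<n. \<Sum>j<n. A i j * x i * x j) + 2 * (- ?r / A k k) * ?r + (- ?r / A k k)\<^sup>2 * A k k"
        using k by (simp add: field_simps power2_eq_square)
      finally show "0 \<le> (\<Sum>i<n. \<Sum>j<n. B i j * x i * x j)"
        using psd[rule_format, of "\<lambda>l. x l + (if l = k then - ?r / A k k else 0)"]
        unfolding quadratic_form_add_unit[OF sym k(1), where x = x and s = "- ?r / A k k"] by linarith
    qed
    \<comment> \<open>Zero diagonal entries stay zero, since elimination can only decrease the
      diagonal while \<open>B\<close> keeps it nonnegative.\<close>
    have "A i i \<noteq> 0" if "i < n" "B i i \<noteq> 0" for i
    proof
      assume "A i i = 0"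
      then have "B i i \<le> 0" using kpos by (simp add: B_def)
      then show False using diag[OF Bsym Bpsd that(1)] that(2) by simp
    qed
    moreover have "B k k = 0" using k by (simp add: B_def)
    ultimately have "{i. i < n \<and> B i i \<noteq> 0} \<subset> {i. i < n \<and> A i i \<noteq> 0}"
      using k by blast
    then have "card {i. i < n \<and> B i i \<noteq> 0} < card {i. i < n \<and> A i i \<noteq> 0}"
      by (intro psubset_card_mono) auto
    from less.hyps[OF this Bsym Bpsd] obtain xs
      where xs: "\<And>i j. i < n \<Longrightarrow> j < n \<Longrightarrow> B i j = (\<Sum>x\<leftarrow>xs. x i * x j)" by blast
    \<comment> \<open>The eliminated term is the square of row \<open>k\<close> divided by the root
      of the pivot.\<close>
    have "A i j = (\<Sum>x\<leftarrow>(\<lambda>l. A k l / sqrt (A k k)) # xs. x i * x j)" if "i < n" "j < n" for i j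
      using xs[OF that] kpos by (simp add: B_def)
    then show ?thesis by blast
  qed
qed

section \<open>Matrices given by lists of rank-one summands\<close>

text \<open>The list records the individual summands, so that its length can be minimised in place
  of the rank. The explicit dimension gives the empty list a zero matrix of the right size.\<close>

definition gram :: "nat \<Rightarrow> real vec list \<Rightarrow> real mat" where
  "gram n xs = mat n n (\<lambda>(i, j). \<Sum>x\<leftarrow>xs. x $ i * x $ j)"

lemma gram_carrier [simp]: "gram n xs \<in> carrier_mat n n"
  by (simp add: gram_def)

lemma gram_dim [simp]: "dim_row (gram n xs) = n" "dim_col (gram n xs) = n"
  by (simp_all add: gram_def)

lemma gram_index [simp]:
  "i < n \<Longrightarrow> j < n \<Longrightarrow> gram n xs $$ (i, j) = (\<Sum>x\<leftarrow>xs. x $ i * x $ j)"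
  by (simp add: gram_def)

lemma quadratic_form_eq_sum:
  fixes A :: "real mat"
  assumes "A \<in> carrier_mat n n" "x \<in> carrier_vec n"
  shows "x \<bullet> (A *\<^sub>v x) = (\<Sum>i<n. \<Sum>j<n. A $$ (i, j) * x $ i * x $ j)"
  using assms
  by (auto simp: scalar_prod_def sum_distrib_left atLeast0LessThan algebra_simps intro!: sum.cong)

text \<open>Each \<open>x\<close> contributes the square of its scalar product with
  \<open>y\<close>.\<close>

lemma sum_list_squares_form_nonneg:
  fixes y :: "nat \<Rightarrow> real"
  shows "0 \<le> (\<Sum>i<n. \<Sum>j<n. (\<Sum>x\<leftarrow>xs. x $ i * x $ j) * y i * y j)"
proof (induction xs)
  case (Cons x xs)
  have "(\<Sum>i<n. \<Sum>j<n. (x $ i * x $ j) * y i * y j) = (\<Sum>i<n. x $ i * y i) * (\<Sum>j<n. x $ j * y j)"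
    unfolding sum_product by (simp add: algebra_simps)
  then show ?case using Cons by (simp add: sum.distrib distrib_right)
qed simp

lemma gram_psd: "gram n xs \<in> psd_mats n"
proof -
  have "0 \<le> y \<bullet> (gram n xs *\<^sub>v y)" if "y \<in> carrier_vec n" for y
  proof -
    have "y \<bullet> (gram n xs *\<^sub>v y) = (\<Sum>i<n. \<Sum>j<n. (\<Sum>x\<leftarrow>xs. x $ i * x $ j) * y $ i * y $ j)"
      using that by (simp add: quadratic_form_eq_sum[of _ n])
    then show ?thesis using sum_list_squares_form_nonneg[where y = "\<lambda>i. y $ i"] by simp
  qed
  moreover have "transpose_mat (gram n xs) = gram n xs"
    by (rule eq_matI) (auto simp: mult.commute)
  ultimately show ?thesis by (simp add: psd_mats_def sym_mats_def)
qed

text \<open>Converse of \<open>gram_psd\<close>: transfers the factorisation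
  \<open>psd_form_sum_of_squares\<close> from functions to matrices.\<close>

lemma psd_mats_eq_gram:
  assumes "A \<in> psd_mats n"
  shows "\<exists>xs. set xs \<subseteq> carrier_vec n \<and> A = gram n xs"
proof -
  have A: "A \<in> carrier_mat n n" "transpose_mat A = A"
    "\<And>x. x \<in> carrier_vec n \<Longrightarrow> 0 \<le> x \<bullet> (A *\<^sub>v x)"
    using assms by (auto simp: psd_mats_def sym_mats_def)
  have "\<forall>i<n. \<forall>j<n. A $$ (i, j) = A $$ (j, i)"
    using A(1) index_transpose_mat(1)[of _ A] unfolding A(2) by auto
  moreover have "\<forall>x. 0 \<le> (\<Sum>i<n. \<Sum>j<n. A $$ (i, j) * x i * x j)"
  proof
    fix x
    show "0 \<le> (\<Sum>i<n. \<Sum>j<n. A $$ (i, j) * x i * x j)"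
      using A(3)[of "vec n x"] A(1) by (simp add: quadratic_form_eq_sum[of _ n])
  qed
  ultimately obtain xs :: "(nat \<Rightarrow> real) list"
    where xs: "\<And>i j. i < n \<Longrightarrow> j < n \<Longrightarrow> A $$ (i, j) = (\<Sum>x\<leftarrow>xs. x i * x j)"
    using psd_form_sum_of_squares[of n "\<lambda>i j. A $$ (i, j)"] by blast
  have "A = gram n (map (vec n) xs)"
    using A(1) by (intro eq_matI) (auto simp: xs o_def)
  then show ?thesis by (intro exI[of _ "map (vec n) xs"]) auto
qed

lemma outer_sq_eq_gram: "v \<in> carrier_vec n \<Longrightarrow> outer_sq v = gram n [v]"
  by (auto simp: outer_sq_def gram_def)

lemma gram_Nil_eq_outer_sq: "gram n [] = outer_sq (0\<^sub>v n)"
  by (rule eq_matI) (auto simp: outer_sq_def)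

lemma rank_outer_sq:
  assumes "v \<in> carrier_vec n"
  shows "vec_space.rank n (outer_sq v) \<le> 1"
  by (rule vec_space.rank_le_1_product_entries[where f = "\<lambda>i. v $ i" and g = "\<lambda>i. v $ i"])
    (use assms in \<open>auto simp: outer_sq_def\<close>)

text \<open>The root of \<open>s\<close> is absorbed into each vector. For \<open>s = 0\<close> the
  empty list is chosen, so that scaling a block to zero really removes its summands.\<close>

lemma gram_smult:
  assumes "0 \<le> s" "set xs \<subseteq> carrier_vec n"
  shows "\<exists>ys. set ys \<subseteq> carrier_vec n \<and> gram n ys = s \<cdot>\<^sub>m gram n xs \<and> length ys \<le> length xs
    \<and> (s = 0 \<longrightarrow> ys = [])"
proof (cases "s = 0")
  case True
  have "gram n [] = s \<cdot>\<^sub>m gram n xs" by (rule eq_matI) (auto simp: True)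
  then show ?thesis by (intro exI[of _ "[]"]) auto
next
  case False
  let ?ys = "map (\<lambda>x. sqrt s \<cdot>\<^sub>v x) xs"
  have "(\<Sum>x\<leftarrow>xs. (sqrt s \<cdot>\<^sub>v x) $ i * (sqrt s \<cdot>\<^sub>v x) $ j) = s * (\<Sum>x\<leftarrow>xs. x $ i * x $ j)"
    if "i < n" "j < n" for i j
    using assms that by (induction xs) (auto simp: algebra_simps)
  then have "gram n ?ys = s \<cdot>\<^sub>m gram n xs"
    by (intro eq_matI) (simp_all add: o_def)
  then show ?thesis using assms False by (intro exI[of _ ?ys]) auto
qed

section \<open>Combinations of two summands\<close>

definition sym_outer :: "nat \<Rightarrow> real vec \<Rightarrow> real vec \<Rightarrow> real mat" where
  "sym_outer n x y = mat n n (\<lambda>(i, j). x $ i * y $ j + y $ i * x $ j)"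

lemma sym_outer_carrier [simp]: "sym_outer n x y \<in> carrier_mat n n"
  by (simp add: sym_outer_def)

text \<open>The right-hand side is \<open>X P X^T\<close> with columns \<open>x\<close>,
  \<open>y\<close> in \<open>X\<close> and \<open>P = ((p, s), (s, r))\<close>. Nonnegative trace
  and determinant make \<open>P\<close> positive semidefinite, and a factorisation of
  \<open>P\<close> needs only one column when its determinant vanishes.\<close>

lemma gram_pair:
  assumes xy: "x \<in> carrier_vec n" "y \<in> carrier_vec n"
    and tr: "0 \<le> p + r" and det: "s\<^sup>2 \<le> p * r"
  shows "\<exists>ys. set ys \<subseteq> carrier_vec n \<and> length ys \<le> 2 \<and> (s\<^sup>2 = p * r \<longrightarrow> length ys \<le> 1) \<and>
    gram n ys = p \<cdot>\<^sub>m gram n [x] + s \<cdot>\<^sub>m sym_outer n x y + r \<cdot>\<^sub>m gram n [y]"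
proof -
  have "0 \<le> p * r" using det zero_le_power2[of s] by linarith
  then have pr: "0 \<le> p" "0 \<le> r" using tr by (auto simp: zero_le_mult_iff)
  show ?thesis
  proof (cases "p = 0")
    case True
    then have "s = 0" using det by simp
    let ?ys = "[sqrt r \<cdot>\<^sub>v y]"
    have "gram n ?ys = p \<cdot>\<^sub>m gram n [x] + s \<cdot>\<^sub>m sym_outer n x y + r \<cdot>\<^sub>m gram n [y]"
      using xy pr \<open>p = 0\<close> \<open>s = 0\<close>
      by (intro eq_matI) (auto simp: sym_outer_def algebra_simps)
    then show ?thesis using xy by (intro exI[of _ ?ys]) auto
  next
    case False
    \<comment> \<open>These come from the Cholesky columns of \<open>P\<close>; the second belongs
      to the Schur complement \<open>r - s\<^sup>2 / p\<close> and is dropped when that is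
      zero.\<close>
    let ?u = "sqrt p \<cdot>\<^sub>v x + (s / sqrt p) \<cdot>\<^sub>v y" and ?w = "sqrt (r - s\<^sup>2 / p) \<cdot>\<^sub>v y"
    let ?ys = "if s\<^sup>2 = p * r then [?u] else [?u, ?w]"
    have p: "0 < p" using False pr by simp
    have w: "0 \<le> r - s\<^sup>2 / p" using det p by (simp add: field_simps)
    have u: "?u $ i * ?u $ j = p * (x $ i * x $ j) + s * (x $ i * y $ j + y $ i * x $ j)
        + s\<^sup>2 / p * (y $ i * y $ j)" if "i < n" "j < n" for i j
    proof -
      obtain g where g: "0 < g" "p = g * g" "sqrt p = g"
        using p by (metis real_sqrt_gt_zero real_sqrt_mult_self abs_of_pos)
      show ?thesis using xy that g unfolding g(3)
        by (simp add: g(2) field_simps power2_eq_square)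
    qed
    have "gram n ?ys = p \<cdot>\<^sub>m gram n [x] + s \<cdot>\<^sub>m sym_outer n x y + r \<cdot>\<^sub>m gram n [y]" (is "?G = ?H")
    proof (rule eq_matI)
      fix i j assume "i < dim_row ?H" "j < dim_col ?H"
      then have ij: "i < n" "j < n" by auto
      have "?w $ i * ?w $ j = (r - s\<^sup>2 / p) * (y $ i * y $ j)"
        using xy ij w by (simp add: algebra_simps)
      moreover have "r = s\<^sup>2 / p" if "s\<^sup>2 = p * r" using that p by simp
      ultimately show "?G $$ (i, j) = ?H $$ (i, j)"
        using u[OF ij] ij by (auto simp: sym_outer_def algebra_simps)
    qed auto
    then show ?thesis using xy by (intro exI[of _ ?ys]) auto
  qed
qed


lemma sym_outer_dim [simp]: "dim_row (sym_outer n x y) = n" "dim_col (sym_outer n x y) = n"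
  by (simp_all add: sym_outer_def)

lemma sym_outer_index [simp]:
  "i < n \<Longrightarrow> j < n \<Longrightarrow> sym_outer n x y $$ (i, j) = x $ i * y $ j + y $ i * x $ j"
  by (simp add: sym_outer_def)

section \<open>Linearity of the inner product and of block sums\<close>

lemma mat_inner_add:
  assumes "A \<in> carrier_mat n n'" "B \<in> carrier_mat n n'" "D \<in> carrier_mat n n'"
  shows "mat_inner A (B + D) = mat_inner A B + mat_inner A D"
  using assms by (simp add: mat_inner_def distrib_left sum.distrib)

lemma mat_inner_smult:
  assumes "A \<in> carrier_mat n n'" "B \<in> carrier_mat n n'"
  shows "mat_inner A (t \<cdot>\<^sub>m B) = t * mat_inner A B"
  using assms by (auto simp: mat_inner_def sum_distrib_left algebra_simps intro!: sum.cong)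

lemma mat_inner_zero:
  assumes "A \<in> carrier_mat n n'"
  shows "mat_inner A (0\<^sub>m n n') = 0"
  using assms by (simp add: mat_inner_def)

lemma block_sum_add_smult:
  assumes "\<And>q. q \<in> {1..Q} \<Longrightarrow> C q k \<in> carrier_mat (n q) (n q)"
    and "\<And>q. q \<in> {1..Q} \<Longrightarrow> V q \<in> carrier_mat (n q) (n q)"
    and "\<And>q. q \<in> {1..Q} \<Longrightarrow> D q \<in> carrier_mat (n q) (n q)"
  shows "block_sum Q C k (\<lambda>q. V q + t \<cdot>\<^sub>m D q) = block_sum Q C k V + t * block_sum Q C k D"
  unfolding block_sum_def sum_distrib_left sum.distrib[symmetric]
proof (rule sum.cong)
  fix q assume "q \<in> {1..Q}"
  with assms[OF this] show "mat_inner (C q k) (V q + t \<cdot>\<^sub>m D q)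
      = mat_inner (C q k) (V q) + t * mat_inner (C q k) (D q)"
    by (simp add: mat_inner_add[of _ "n q" "n q"] mat_inner_smult[of _ "n q" "n q"])
qed simp

section \<open>Optimality and the relaxation\<close>

text \<open>Replaces extended-real infima by comparison with every feasible point, the form of
  optimality used from here on.\<close>

lemma ereal_eq_INF_iff:
  fixes g :: "'a \<Rightarrow> real"
  assumes "v \<in> F"
  shows "ereal (g v) = (INF w\<in>F. ereal (g w)) \<longleftrightarrow> (\<forall>w\<in>F. g v \<le> g w)"
proof
  assume eq: "ereal (g v) = (INF w\<in>F. ereal (g w))"
  show "\<forall>w\<in>F. g v \<le> g w"
  proof
    fix w assume "w \<in> F"
    then have "(INF w\<in>F. ereal (g w)) \<le> ereal (g w)" by (rule INF_lower)
    then show "g v \<le> g w" unfolding eq[symmetric] by simp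
  qed
next
  assume "\<forall>w\<in>F. g v \<le> g w"
  then show "ereal (g v) = (INF w\<in>F. ereal (g w))"
    by (intro antisym INF_greatest INF_lower assms) auto
qed

lemma sdpr_optimal_iff:
  "sdpr_optimal Q n m C R \<delta> V \<longleftrightarrow> V \<in> sdpr_feasible Q n m C R \<delta> \<and>
    (\<forall>W \<in> sdpr_feasible Q n m C R \<delta>. block_sum Q C 0 V \<le> block_sum Q C 0 W)"
  unfolding sdpr_optimal_def sdpr_value_def
  using ereal_eq_INF_iff[of V _ "block_sum Q C 0"] by blast

lemma qcqp_optimal_iff:
  "qcqp_optimal Q n m C R \<delta> v \<longleftrightarrow> v \<in> qcqp_feasible Q n m C R \<delta> \<and>
    (\<forall>w \<in> qcqp_feasible Q n m C R \<delta>.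
      block_sum Q C 0 (\<lambda>q. outer_sq (v q)) \<le> block_sum Q C 0 (\<lambda>q. outer_sq (w q)))"
  unfolding qcqp_optimal_def qcqp_value_def
  using ereal_eq_INF_iff[of v _ "\<lambda>v. block_sum Q C 0 (\<lambda>q. outer_sq (v q))"] by blast

text \<open>This makes (SDPR) a relaxation: its minimum bounds the objective of every feasible point
  of (QCQP) from below.\<close>

lemma qcqp_feasible_imp_sdpr_feasible:
  assumes "w \<in> qcqp_feasible Q n m C R \<delta>"
  shows "(\<lambda>q. outer_sq (w q)) \<in> sdpr_feasible Q n m C R \<delta>"
  using assms by (auto simp: qcqp_feasible_def sdpr_feasible_def outer_sq_eq_gram gram_psd)

section \<open>Removing a summand or a slack\<close>

text \<open>Eigenvalues of the symmetric matrix \<open>((a, b), (b, d))\<close>, real because the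
  discriminant is a sum of squares.\<close>

lemma obtain_eigenvalues_2x2:
  fixes a b d :: real
  obtains l1 l2 where "l1 + l2 = a + d" "l1 * l2 = a * d - b\<^sup>2"
proof -
  define r where "r = sqrt (((a - d) / 2)\<^sup>2 + b\<^sup>2)"
  have "r\<^sup>2 = ((a - d) / 2)\<^sup>2 + b\<^sup>2" by (simp add: r_def)
  then have "((a + d) / 2 + r) * ((a + d) / 2 - r) = a * d - b\<^sup>2"
    by (simp add: power2_eq_square field_simps)
  then show ?thesis by (intro that[of "(a + d) / 2 + r" "(a + d) / 2 - r"]) auto
qed

lemma obtain_max_abs:
  fixes M :: "real set"
  assumes "finite M" "\<nu> \<in> M" "\<nu> \<noteq> 0"
  obtains \<mu> where "\<mu> \<in> M" "\<mu> \<noteq> 0" "\<And>\<nu>. \<nu> \<in> M \<Longrightarrow> \<bar>\<nu>\<bar> \<le> \<bar>\<mu>\<bar>"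
proof -
  have "Max (abs ` M) \<in> abs ` M" using assms by (intro Max_in) auto
  then obtain \<mu> where \<mu>: "\<mu> \<in> M" "Max (abs ` M) = \<bar>\<mu>\<bar>" by auto
  have le: "\<bar>\<nu>\<bar> \<le> \<bar>\<mu>\<bar>" if "\<nu> \<in> M" for \<nu>
    unfolding \<mu>(2)[symmetric] using assms that by (intro Max_ge) auto
  with assms have "\<mu> \<noteq> 0" by force
  with \<mu> le show ?thesis by (intro that[of \<mu>]) auto
qed

text \<open>The coefficient matrix of the pair \<open>x\<close>, \<open>y\<close> moves from the
  identity to \<open>I + t N\<close> with \<open>N = ((a, b), (b, d))\<close>, whose eigenvalues are
  \<open>1 + t * l1\<close> and \<open>1 + t * l2\<close>. \<open>gram_pair\<close> applies while
  both are nonnegative and saves a vector when one vanishes.\<close>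

lemma gram_pair_perturb:
  assumes xy: "x \<in> carrier_vec n" "y \<in> carrier_vec n"
    and l: "l1 + l2 = a + d" "l1 * l2 = a * d - b\<^sup>2"
    and t: "0 \<le> 1 + t * l1" "0 \<le> 1 + t * l2"
  shows "\<exists>ys. set ys \<subseteq> carrier_vec n \<and> length ys \<le> 2
    \<and> ((1 + t * l1) * (1 + t * l2) = 0 \<longrightarrow> length ys \<le> 1)
    \<and> gram n (x # y # zs) + t \<cdot>\<^sub>m (a \<cdot>\<^sub>m gram n [x] + b \<cdot>\<^sub>m sym_outer n x y + d \<cdot>\<^sub>m gram n [y])
      = gram n (ys @ zs)"
proof -
  have det: "(1 + t * a) * (1 + t * d) - (t * b)\<^sup>2 = (1 + t * l1) * (1 + t * l2)"
  proof -
    have "(1 + t * a) * (1 + t * d) - (t * b)\<^sup>2 = 1 + t * (a + d) + t\<^sup>2 * (a * d - b\<^sup>2)"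
      by (simp add: power2_eq_square algebra_simps)
    also have "\<dots> = (1 + t * l1) * (1 + t * l2)"
      unfolding l[symmetric] by (simp add: power2_eq_square algebra_simps)
    finally show ?thesis .
  qed
  have "(1 + t * a) + (1 + t * d) = (1 + t * l1) + (1 + t * l2)"
    using arg_cong[OF l(1), of "\<lambda>u. t * u"] by (simp add: algebra_simps)
  then have tr: "0 \<le> (1 + t * a) + (1 + t * d)" using t by simp
  have le: "(t * b)\<^sup>2 \<le> (1 + t * a) * (1 + t * d)"
    using det mult_nonneg_nonneg[OF t] by linarith
  obtain ys where ys: "set ys \<subseteq> carrier_vec n" "length ys \<le> 2"
    "(t * b)\<^sup>2 = (1 + t * a) * (1 + t * d) \<longrightarrow> length ys \<le> 1"
    "gram n ys = (1 + t * a) \<cdot>\<^sub>m gram n [x] + (t * b) \<cdot>\<^sub>m sym_outer n x y + (1 + t * d) \<cdot>\<^sub>m gram n [y]"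
    using gram_pair[OF xy tr le] by blast
  have "gram n (x # y # zs) + t \<cdot>\<^sub>m (a \<cdot>\<^sub>m gram n [x] + b \<cdot>\<^sub>m sym_outer n x y + d \<cdot>\<^sub>m gram n [y])
      = gram n (ys @ zs)" (is "?G = ?H")
  proof (rule eq_matI)
    fix i j assume "i < dim_row ?H" "j < dim_col ?H"
    then have ij: "i < n" "j < n" by auto
    have "(\<Sum>z\<leftarrow>ys. z $ i * z $ j) = gram n ys $$ (i, j)" using ij by simp
    also have "\<dots> = (1 + t * a) * (x $ i * x $ j) + t * b * (x $ i * y $ j + y $ i * x $ j)
      + (1 + t * d) * (y $ i * y $ j)"
      unfolding ys(4) using ij by simp
    finally show "?G $$ (i, j) = ?H $$ (i, j)" using ij by (simp add: algebra_simps)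
  qed auto
  moreover have "(1 + t * l1) * (1 + t * l2) = 0 \<longrightarrow> length ys \<le> 1" using ys(3) det by auto
  ultimately show ?thesis using ys by blast
qed

text \<open>The descent step for the number of summands plus nonzero slacks. \<open>count\<close>
  says exactly that the unknowns outnumber the \<open>m\<close> equations: the block
  \<open>q0\<close> offers three parameters instead of one, hence the \<open>+ 2\<close>.\<close>

lemma sdpr_reduction_step:
  assumes opt: "sdpr_optimal Q n m C R \<delta> V"
    and C: "\<And>q k. q \<in> {1..Q} \<Longrightarrow> k \<le> m \<Longrightarrow> C q k \<in> carrier_mat (n q) (n q)"
    and R: "\<forall>k \<in> {1..m}. R k \<in> {(\<le>), (=), (\<ge>)}"
    and L: "\<And>q. q \<in> {1..Q} \<Longrightarrow> set (L q) \<subseteq> carrier_vec (n q) \<and> V q = gram (n q) (L q)"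
    and q0: "q0 \<in> {1..Q}" "L q0 = x # y # zs"
    and count: "m < card {q \<in> {1..Q}. L q \<noteq> []} + card {k \<in> {1..m}. \<delta> k - block_sum Q C k V \<noteq> 0} + 2"
  shows "\<exists>V' L'. sdpr_optimal Q n m C R \<delta> V'
    \<and> (\<forall>q\<in>{1..Q}. set (L' q) \<subseteq> carrier_vec (n q) \<and> V' q = gram (n q) (L' q))
    \<and> (\<Sum>q = 1..Q. length (L' q)) + card {k \<in> {1..m}. \<delta> k - block_sum Q C k V' \<noteq> 0}
      < (\<Sum>q = 1..Q. length (L q)) + card {k \<in> {1..m}. \<delta> k - block_sum Q C k V \<noteq> 0}"
proof -
  define s where "s k = \<delta> k - block_sum Q C k V" for k
  define S where "S = {k \<in> {1..m}. s k \<noteq> 0}"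
  define B where "B = {q \<in> {1..Q}. L q \<noteq> []} - {q0}"
  define E where "E j = (if j = 0 then gram (n q0) [x] else if j = 1 then sym_outer (n q0) x y
    else gram (n q0) [y])" for j :: nat
  \<comment> \<open>Coefficient of parameter \<open>i\<close> in equation \<open>k\<close>, which
    demands that the change of constraint \<open>k\<close> be cancelled by that of its slack. The
    parameters scale a block, scale a slack, or combine the three directions
    \<open>E\<close>.\<close>
  define f where "f k i = (case i of Inl q \<Rightarrow> mat_inner (C q k) (V q)
    | Inr (Inl l) \<Rightarrow> (if l = k then s k else 0) | Inr (Inr j) \<Rightarrow> mat_inner (C q0 k) (E j))"
    for k and i :: "nat + nat + nat"
  define I where "I = B <+> (S <+> {0, 1, 2::nat})"
  have fin [simp]: "finite B" "finite S" by (auto simp: B_def S_def)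
  have xy: "x \<in> carrier_vec (n q0)" "y \<in> carrier_vec (n q0)" using L[OF q0(1)] q0 by auto
  have Vc: "V q \<in> carrier_mat (n q) (n q)" if "q \<in> {1..Q}" for q using L[OF that] by simp
  have "card {q \<in> {1..Q}. L q \<noteq> []} = Suc (card B)"
    unfolding B_def using q0 by (intro card.remove) auto
  then have "card {1..m} < card I"
    using count by (simp add: I_def card_Plus s_def S_def)
  then obtain c where c: "\<exists>i\<in>I. c i \<noteq> 0" "\<forall>k\<in>{1..m}. (\<Sum>i\<in>I. c i * f k i) = 0"
    using homogeneous_system_nontrivial_solution[of "{1..m}" I f] by (auto simp: I_def)
  define \<alpha> where "\<alpha> q = c (Inl q)" for q
  \<comment> \<open>The default 0 keeps vanishing slacks at zero, so active constraints stay
    active.\<close>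
  define \<beta> where "\<beta> k = (if k \<in> S then c (Inr (Inl k)) else 0)" for k
  define a b d where "a = c (Inr (Inr 0))" and "b = c (Inr (Inr 1))" and "d = c (Inr (Inr 2))"
  \<comment> \<open>Blocks without summands are zero matrices and are not moved.\<close>
  define D where "D q = (if q = q0 then a \<cdot>\<^sub>m E 0 + b \<cdot>\<^sub>m E 1 + d \<cdot>\<^sub>m E 2
    else if q \<in> B then \<alpha> q \<cdot>\<^sub>m V q else 0\<^sub>m (n q) (n q))" for q
  have E: "E j \<in> carrier_mat (n q0) (n q0)" for j by (simp add: E_def)
  have Dc: "D q \<in> carrier_mat (n q) (n q)" if "q \<in> {1..Q}" for q
    using Vc[OF that] E by (simp add: D_def)
  have blockD: "block_sum Q C k D = - \<beta> k * s k" if k: "k \<in> {1..m}" for k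
  proof -
    have km: "k \<le> m" using k by simp
    have "(\<Sum>q\<in>{1..Q} - {q0}. mat_inner (C q k) (D q)) = (\<Sum>q\<in>B. mat_inner (C q k) (D q))"
      by (rule sum.mono_neutral_right)
        (use C[OF _ km] in \<open>auto simp: B_def D_def intro: mat_inner_zero\<close>)
    also have "\<dots> = (\<Sum>q\<in>B. \<alpha> q * mat_inner (C q k) (V q))"
    proof (rule sum.cong)
      fix q assume "q \<in> B"
      then have "q \<in> {1..Q}" "q \<noteq> q0" by (auto simp: B_def)
      with \<open>q \<in> B\<close> show "mat_inner (C q k) (D q) = \<alpha> q * mat_inner (C q k) (V q)"
        using mat_inner_smult[OF C[OF \<open>q \<in> {1..Q}\<close> km] Vc[OF \<open>q \<in> {1..Q}\<close>]] by (simp add: D_def)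
    qed simp
    also have "mat_inner (C q0 k) (D q0) = a * mat_inner (C q0 k) (E 0)
        + b * mat_inner (C q0 k) (E 1) + d * mat_inner (C q0 k) (E 2)"
      using E C[OF q0(1) km]
      by (simp add: D_def mat_inner_add[of _ "n q0" "n q0"] mat_inner_smult[of _ "n q0" "n q0"])
    moreover have "block_sum Q C k D = mat_inner (C q0 k) (D q0)
        + (\<Sum>q\<in>{1..Q} - {q0}. mat_inner (C q k) (D q))"
      unfolding block_sum_def using q0 by (intro sum.remove) auto
    moreover have "(\<Sum>l\<in>S. c (Inr (Inl l)) * (if l = k then s k else 0)) = \<beta> k * s k"
      by (simp add: \<beta>_def if_distrib cong: if_cong)
    then have "(\<Sum>i\<in>I. c i * f k i) = (\<Sum>q\<in>B. \<alpha> q * mat_inner (C q k) (V q)) + (\<beta> k * s k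
        + (a * mat_inner (C q0 k) (E 0) + (b * mat_inner (C q0 k) (E 1) + d * mat_inner (C q0 k) (E 2))))"
      unfolding I_def by (simp add: sum.Plus f_def o_def \<alpha>_def a_def b_def d_def)
    ultimately show ?thesis using c(2) k by simp
  qed
  obtain l1 l2 where l: "l1 + l2 = a + d" "l1 * l2 = a * d - b\<^sup>2"
    by (rule obtain_eigenvalues_2x2)
  define M where "M = \<alpha> ` B \<union> \<beta> ` S \<union> {l1, l2}"
    \<comment> \<open>A step of length \<open>t\<close> is feasible as soon as \<open>1 + t * \<nu> \<ge> 0\<close> for all \<open>\<nu> \<in> M\<close>, and it removes a
      summand or a slack if one of these numbers vanishes. If \<open>\<mu> \<in> M\<close> has maximal modulus, then both
      \<open>t = 1 / \<mu>\<close> and \<open>t = - 1 / \<mu>\<close> are feasible, and the latter makes \<open>1 + t * \<mu>\<close> vanish.\<close>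
  have "\<exists>\<nu>\<in>M. \<nu> \<noteq> 0"
  proof (rule ccontr)
    assume "\<not> ?thesis"
    then have z: "\<And>q. q \<in> B \<Longrightarrow> \<alpha> q = 0" "\<And>k. k \<in> S \<Longrightarrow> \<beta> k = 0" "l1 = 0" "l2 = 0"
      by (auto simp: M_def)
    \<comment> \<open>A symmetric matrix with both eigenvalues zero is zero: \<open>d = - a\<close>
      turns the determinant condition into \<open>a\<^sup>2 + b\<^sup>2 = 0\<close>.\<close>
    have d: "d = - a" using l(1) z(3,4) by simp
    have "a * d = b\<^sup>2" using l(2) z(3) by simp
    then have "- a\<^sup>2 = b\<^sup>2" by (simp add: d power2_eq_square)
    then have "a\<^sup>2 + b\<^sup>2 = 0" by linarith
    then have "a = 0" "b = 0" "d = 0" using d by (auto simp: sum_power2_eq_zero_iff)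
    then show False using c(1) z(1,2) by (auto simp: I_def \<alpha>_def \<beta>_def a_def b_def d_def)
  qed
  moreover have "finite M" by (simp add: M_def)
  ultimately obtain \<mu> where \<mu>: "\<mu> \<in> M" "\<mu> \<noteq> 0" "\<And>\<nu>. \<nu> \<in> M \<Longrightarrow> \<bar>\<nu>\<bar> \<le> \<bar>\<mu>\<bar>"
    using obtain_max_abs[of M] by metis
  define W where "W t q = V q + t \<cdot>\<^sub>m D q" for t q
  define good where "good t \<longleftrightarrow> (\<forall>\<nu>\<in>M. 0 \<le> 1 + t * \<nu>)" for t
  have blockW: "block_sum Q C k (W t) = block_sum Q C k V + t * block_sum Q C k D"
    if "k \<le> m" for k t
    unfolding W_def by (rule block_sum_add_smult[of Q C k n]) (use C that Vc Dc in auto)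
  have slackW: "\<delta> k - block_sum Q C k (W t) = (1 + t * \<beta> k) * s k" if "k \<in> {1..m}" for k t
    using blockW[of k t] blockD[OF that] that by (simp add: s_def algebra_simps)
  \<comment> \<open>No list grows, and the list of a block shortens as soon as its factor vanishes;
    blocks in \<open>B\<close> have a nonempty list to lose.\<close>
  have rep: "\<exists>L'. \<forall>q\<in>{1..Q}. set (L' q) \<subseteq> carrier_vec (n q) \<and> W t q = gram (n q) (L' q)
      \<and> length (L' q) \<le> length (L q)
      \<and> (q \<in> B \<and> 1 + t * \<alpha> q = 0 \<or> q = q0 \<and> (1 + t * l1) * (1 + t * l2) = 0
         \<longrightarrow> length (L' q) < length (L q))" if "good t" for t
  proof (rule bchoice, rule ballI)
    fix q assume q: "q \<in> {1..Q}"
    note Lq = L[OF q]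
    consider "q = q0" | "q \<noteq> q0" "q \<in> B" | "q \<noteq> q0" "q \<notin> B" by blast
    then show "\<exists>ys. set ys \<subseteq> carrier_vec (n q) \<and> W t q = gram (n q) ys
      \<and> length ys \<le> length (L q)
      \<and> (q \<in> B \<and> 1 + t * \<alpha> q = 0 \<or> q = q0 \<and> (1 + t * l1) * (1 + t * l2) = 0
         \<longrightarrow> length ys < length (L q))"
    proof cases
      case 1
      have "0 \<le> 1 + t * l1" "0 \<le> 1 + t * l2" using that by (auto simp: good_def M_def)
      from gram_pair_perturb[OF xy l this, of zs] obtain ys where
        "set ys \<subseteq> carrier_vec (n q0)" "length ys \<le> 2"
        "(1 + t * l1) * (1 + t * l2) = 0 \<longrightarrow> length ys \<le> 1"
        "W t q0 = gram (n q0) (ys @ zs)"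
        using Lq 1 q0 by (auto simp: W_def D_def E_def)
      then show ?thesis using 1 q0 Lq
        by (intro exI[of _ "ys @ zs"]) (auto simp: B_def)
    next
      case 2
      have "0 \<le> 1 + t * \<alpha> q" using that 2 by (auto simp: good_def M_def)
      from gram_smult[OF this conjunct1[OF Lq]] obtain ys where
        "set ys \<subseteq> carrier_vec (n q)" "gram (n q) ys = (1 + t * \<alpha> q) \<cdot>\<^sub>m gram (n q) (L q)"
        "length ys \<le> length (L q)" "1 + t * \<alpha> q = 0 \<longrightarrow> ys = []" by blast
      moreover have "W t q = (1 + t * \<alpha> q) \<cdot>\<^sub>m gram (n q) (L q)"
        using 2 Lq by (intro eq_matI) (auto simp: W_def D_def algebra_simps)
      ultimately show ?thesis using 2 by (intro exI[of _ ys]) (auto simp: B_def)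
    next
      case 3
      have "W t q = gram (n q) (L q)"
        using 3 Lq by (intro eq_matI) (auto simp: W_def D_def)
      then show ?thesis using 3 Lq by (intro exI[of _ "L q"]) auto
    qed
  qed
  have feasV: "V \<in> sdpr_feasible Q n m C R \<delta>" and
    minV: "\<And>W. W \<in> sdpr_feasible Q n m C R \<delta> \<Longrightarrow> block_sum Q C 0 V \<le> block_sum Q C 0 W"
    using opt by (auto simp: sdpr_optimal_iff)
  have feas: "W t \<in> sdpr_feasible Q n m C R \<delta>" if "good t" for t
  proof -
    have "W t q \<in> psd_mats (n q)" if "q \<in> {1..Q}" for q
      using rep[OF \<open>good t\<close>] that gram_psd by metis
    moreover have "R k (block_sum Q C k (W t)) (\<delta> k)" if k: "k \<in> {1..m}" for k
    proof -
      have nn: "0 \<le> 1 + t * \<beta> k"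
        using \<open>good t\<close> by (cases "k \<in> S") (auto simp: good_def M_def \<beta>_def)
      have RV: "R k (block_sum Q C k V) (\<delta> k)" using feasV k by (simp add: sdpr_feasible_def)
      \<comment> \<open>A nonnegative factor never reverses the sign of a slack and leaves a zero
        slack at zero, which preserves each of the three relations.\<close>
      from R k consider "R k = (\<le>)" | "R k = (=)" | "R k = (\<ge>)" by blast
      then show ?thesis
      proof cases
        case 1
        with RV have "0 \<le> s k" by (simp add: s_def)
        with 1 show ?thesis using slackW[OF k, of t] mult_nonneg_nonneg[OF nn, of "s k"] by simp
      next
        case 2
        with RV have "s k = 0" by (simp add: s_def)
        with 2 show ?thesis using slackW[OF k, of t] by simp
      next
        case 3
        with RV have "s k \<le> 0" by (simp add: s_def)
        with 3 show ?thesis using slackW[OF k, of t] mult_nonneg_nonpos[OF nn, of "s k"] by simp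
      qed
    qed
    ultimately show ?thesis by (simp add: sdpr_feasible_def)
  qed
  have bound: "\<bar>\<nu> / \<mu>\<bar> \<le> 1" if "\<nu> \<in> M" for \<nu>
    using \<mu>(3)[OF that] \<mu>(2) by (simp add: abs_divide)
  have good1: "good (1 / \<mu>)" and good2: "good (- 1 / \<mu>)"
    unfolding good_def using bound by (fastforce simp: abs_le_iff simp del: abs_divide)+
  have "block_sum Q C 0 D = 0"
    \<comment> \<open>\<open>V\<close> lies in the relative interior of the feasible segment in direction \<open>D\<close>, so optimality
      forces the objective to be constant on it.\<close>
  proof -
    have "0 \<le> block_sum Q C 0 D / \<mu>" "0 \<le> - (block_sum Q C 0 D / \<mu>)"
      using minV[OF feas[OF good1]] minV[OF feas[OF good2]] by (auto simp: blockW)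
    then show ?thesis using \<mu>(2) by simp
  qed
  then have optW: "sdpr_optimal Q n m C R \<delta> (W (- 1 / \<mu>))"
    using feas[OF good2] minV by (simp add: sdpr_optimal_iff blockW)
  obtain L' where L': "\<And>q. q \<in> {1..Q} \<Longrightarrow> set (L' q) \<subseteq> carrier_vec (n q) \<and> W (- 1 / \<mu>) q = gram (n q) (L' q)"
    and len: "\<And>q. q \<in> {1..Q} \<Longrightarrow> length (L' q) \<le> length (L q)"
    and lt: "\<And>q. q \<in> {1..Q} \<Longrightarrow> q \<in> B \<and> 1 + (- 1 / \<mu>) * \<alpha> q = 0
      \<or> q = q0 \<and> (1 + (- 1 / \<mu>) * l1) * (1 + (- 1 / \<mu>) * l2) = 0 \<Longrightarrow> length (L' q) < length (L q)"
    using rep[OF good2] by blast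
  let ?S = "{k \<in> {1..m}. \<delta> k - block_sum Q C k (W (- 1 / \<mu>)) \<noteq> 0}"
  \<comment> \<open>No new nonzero slack appears, since every slack is only multiplied by a
    factor.\<close>
  have S': "?S = {k \<in> S. 1 + (- 1 / \<mu>) * \<beta> k \<noteq> 0}"
  proof -
    have "?S = {k \<in> {1..m}. (1 + (- 1 / \<mu>) * \<beta> k) * s k \<noteq> 0}"
      by (intro Collect_cong conj_cong refl) (simp only: slackW)
    then show ?thesis unfolding S_def by (simp only: mult_eq_0_iff) blast
  qed
  have card_le: "card ?S \<le> card S" unfolding S' by (intro card_mono) auto
  have sum_le: "(\<Sum>q = 1..Q. length (L' q)) \<le> (\<Sum>q = 1..Q. length (L q))"
    using len by (intro sum_mono)
  have sum_lt: "(\<Sum>q = 1..Q. length (L' q)) < (\<Sum>q = 1..Q. length (L q))"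
    if "q \<in> {1..Q}" "length (L' q) < length (L q)" for q
    using len that by (intro sum_strict_mono_ex1) auto
  have hit: "1 + (- 1 / \<mu>) * \<mu> = 0" using \<mu>(2) by simp
  \<comment> \<open>The vanishing factor belongs to a block, a slack or the pair in
    \<open>q0\<close>; it lowers one of the two counts while the other does not increase.\<close>
  consider q where "q \<in> B" "\<mu> = \<alpha> q" | k where "k \<in> S" "\<mu> = \<beta> k" | "\<mu> = l1 \<or> \<mu> = l2"
    using \<mu>(1) by (auto simp: M_def)
  then have "(\<Sum>q = 1..Q. length (L' q)) + card ?S < (\<Sum>q = 1..Q. length (L q)) + card S"
  proof cases
    case 1
    then have "q \<in> {1..Q}" by (auto simp: B_def)
    then show ?thesis using sum_lt[of q] lt[of q] hit 1 card_le by auto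
  next
    case 2
    then have "?S \<subset> S" unfolding S' using hit by blast
    then have "card ?S < card S" by (intro psubset_card_mono) auto
    then show ?thesis using sum_le by simp
  next
    case 3
    then have "(1 + (- 1 / \<mu>) * l1) * (1 + (- 1 / \<mu>) * l2) = 0" using hit by auto
    then show ?thesis using sum_lt[OF q0(1)] lt[OF q0(1)] card_le by auto
  qed
  then show ?thesis using optW L' unfolding S_def s_def by blast
qed

section \<open>Rank-one solutions from a minimal representation\<close>

theorem theorem4p4:
  fixes Q m :: nat
    and n :: "nat \<Rightarrow> nat"
    and C :: "nat \<Rightarrow> nat \<Rightarrow> real mat"
    and \<delta> :: "nat \<Rightarrow> real"
    and R :: "nat \<Rightarrow> real \<Rightarrow> real \<Rightarrow> bool"
  assumes "0 < Q" and "0 < m"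
    and "\<forall>q \<in> {1..Q}. 0 < n q"
    and "\<forall>q \<in> {1..Q}. \<forall>k \<in> {0..m}. C q k \<in> sym_mats (n q)"
    and "\<forall>k \<in> {1..m}. R k \<in> {(\<le>), (=), (\<ge>)}"
    and A: "\<forall>V. sdpr_optimal Q n m C R \<delta> V \<longrightarrow>
      m - 1 \<le> card {q \<in> {1..Q}. V q \<noteq> 0\<^sub>m (n q) (n q)}
             + card {k \<in> {1..m}. \<delta> k - block_sum Q C k V \<noteq> 0}"
    and B: "\<exists>V. sdpr_optimal Q n m C R \<delta> V"
  shows "\<exists>V. sdpr_optimal Q n m C R \<delta> V \<and>
      (\<forall>q \<in> {1..Q}. vec_space.rank (n q) (V q) \<le> 1) \<and>
      (\<exists>v. (\<forall>q \<in> {1..Q}. v q \<in> carrier_vec (n q) \<and> V q = outer_sq (v q)) \<and>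
           qcqp_optimal Q n m C R \<delta> v)"
proof -
  \<comment> \<open>Solution and representation are minimised jointly under \<open>\<phi>\<close>,
    because a reduction step changes both.\<close>
  define P where "P V L \<longleftrightarrow> sdpr_optimal Q n m C R \<delta> V \<and>
    (\<forall>q\<in>{1..Q}. set (L q) \<subseteq> carrier_vec (n q) \<and> V q = gram (n q) (L q))" for V L
  define \<phi> where "\<phi> V L = (\<Sum>q = 1..Q. length (L q :: real vec list))
    + card {k \<in> {1..m}. \<delta> k - block_sum Q C k V \<noteq> 0}" for V L
  have "\<exists>V L. P V L"
  proof -
    obtain V where V: "sdpr_optimal Q n m C R \<delta> V" using B by blast
    then have "\<forall>q\<in>{1..Q}. V q \<in> psd_mats (n q)"
      by (simp add: sdpr_optimal_def sdpr_feasible_def)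
    then have "\<exists>L. \<forall>q\<in>{1..Q}. set (L q) \<subseteq> carrier_vec (n q) \<and> V q = gram (n q) (L q)"
      by (intro bchoice ballI psd_mats_eq_gram) auto
    then show ?thesis using V by (auto simp: P_def)
  qed
  then obtain V L where VL: "P V L" and least: "\<And>V' L'. P V' L' \<Longrightarrow> \<phi> V L \<le> \<phi> V' L'"
    using ex_has_least_nat[of "\<lambda>(V, L). P V L" _ "\<lambda>(V, L). \<phi> V L"] by fastforce
  have opt: "sdpr_optimal Q n m C R \<delta> V"
    and L: "\<And>q. q \<in> {1..Q} \<Longrightarrow> set (L q) \<subseteq> carrier_vec (n q) \<and> V q = gram (n q) (L q)"
    using VL by (auto simp: P_def)
  have short: "length (L q) \<le> 1" if q: "q \<in> {1..Q}" for q
  proof (rule ccontr)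
    assume "\<not> length (L q) \<le> 1"
    then obtain x y zs where xy: "L q = x # y # zs"
      by (cases "L q"; cases "tl (L q)") auto
    \<comment> \<open>A nonzero block has a nonempty list, so the bound in (A) carries over to the
      number of nonempty lists.\<close>
    have "V p = 0\<^sub>m (n p) (n p)" if "p \<in> {1..Q}" "L p = []" for p
      using L[OF that(1)] that(2) by (auto intro!: eq_matI)
    then have "card {q \<in> {1..Q}. V q \<noteq> 0\<^sub>m (n q) (n q)} \<le> card {q \<in> {1..Q}. L q \<noteq> []}"
      by (intro card_mono) auto
    moreover have "m - 1 \<le> card {q \<in> {1..Q}. V q \<noteq> 0\<^sub>m (n q) (n q)}
        + card {k \<in> {1..m}. \<delta> k - block_sum Q C k V \<noteq> 0}"
      using A opt by blast
    ultimately have count: "m < card {q \<in> {1..Q}. L q \<noteq> []}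
        + card {k \<in> {1..m}. \<delta> k - block_sum Q C k V \<noteq> 0} + 2" by linarith
    have C: "C q k \<in> carrier_mat (n q) (n q)" if "q \<in> {1..Q}" "k \<le> m" for q k
      using assms(4) that by (auto simp: sym_mats_def)
    obtain V' L' where "P V' L'" "\<phi> V' L' < \<phi> V L"
      using sdpr_reduction_step[OF opt C assms(5) L q xy count] by (auto simp: P_def \<phi>_def)
    then show False using least by fastforce
  qed
  \<comment> \<open>An empty list stands for the zero block, whose vector is zero.\<close>
  define v where "v q = (case L q of [] \<Rightarrow> 0\<^sub>v (n q) | x # _ \<Rightarrow> x)" for q
  have v: "v q \<in> carrier_vec (n q) \<and> V q = outer_sq (v q)" if q: "q \<in> {1..Q}" for q
    using L[OF q] short[OF q]
    by (cases "L q") (auto simp: v_def gram_Nil_eq_outer_sq outer_sq_eq_gram)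
  have eq: "block_sum Q C k (\<lambda>q. outer_sq (v q)) = block_sum Q C k V" for k
    unfolding block_sum_def by (rule sum.cong) (use v in auto)
  have "v \<in> qcqp_feasible Q n m C R \<delta>"
    using opt v by (auto simp: qcqp_feasible_def sdpr_optimal_def sdpr_feasible_def eq)
  \<comment> \<open>\<open>v\<close> attains the minimum of (SDPR), which is a lower bound for
    (QCQP).\<close>
  then have "qcqp_optimal Q n m C R \<delta> v"
    using opt qcqp_feasible_imp_sdpr_feasible
    by (auto simp: qcqp_optimal_iff sdpr_optimal_iff eq)
  moreover have "vec_space.rank (n q) (V q) \<le> 1" if "q \<in> {1..Q}" for q
    using v[OF that] rank_outer_sq by simp
  ultimately show ?thesis using opt v by blast
qed

end
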